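(* The integrality gap of the subtour LP restricted to symmetric circulant TSP instances is exactly $2$; that is, $$\sup_{n}\ \sup_{(c_1,\dots,c_d)\in\mathbb{R}^d_{\ge 0}}\frac{\mathrm{TSPOPT}(c_1,\dots,c_d)}{\mathrm{LPOPT}(c_1,\dots,c_d)}=2.$$
   Context: For $n\ge 3$ let $d=\lfloor n/2\rfloor$. A symmetric circulant TSP instance on $K_n$ (vertices $[n]$, arithmetic mod $n$) is given by stripe costs $c_1,\dots,c_d\ge0$: edge $\{i,j\}$ has cost $c_k$ where $k=\min\{(i-j)\bmod n,(j-i)\bmod n\}$. $\mathrm{TSPOPT}(c_1,\dots,c_d)$ is the minimum cost of a Hamiltonian cycle in $K_n$. $\mathrm{LPOPT}(c_1,\dots,c_d)$ is the optimal value of the subtour LP: minimize $\sum_{e}c_ex_e$ subject to $\sum_{e\in\delta(v)}x_e=2$ for all vertices $v$, $\sum_{e\in\delta(S)}x_e\ge2$ for all $\emptyset\neq S\subsetneq[n]$, $0\le x_e\le1$, where $\delta(S)$ is the set of edges with exactly one endpoint in $S$. *)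

theory Defs
  imports Complex_Main "HOL-Library.Extended_Real" "HOL-Library.FuncSet"
begin

definition verts :: "nat \<Rightarrow> nat set" where
  "verts n = {1..n}"

definition edges :: "nat \<Rightarrow> nat set set" where
  "edges n = {{i, j} | i j. i \<in> verts n \<and> j \<in> verts n \<and> i \<noteq> j}"

definition circ_dist :: "nat \<Rightarrow> nat \<Rightarrow> nat \<Rightarrow> nat" where
  "circ_dist n i j = nat (min ((int i - int j) mod int n) ((int j - int i) mod int n))"

text \<open>
  Since \<^term>\<open>circ_dist n\<close> is symmetric, the two endpoints of an edge may be taken in any
  order; we take the smaller one first. Only the values of \<open>c\<close> on \<open>{1..n div 2}\<close> are used
  for edges of the complete graph.
\<close>

definition edge_cost :: "nat \<Rightarrow> (nat \<Rightarrow> real) \<Rightarrow> nat set \<Rightarrow> real" where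
  "edge_cost n c e = c (circ_dist n (Min e) (Max e))"

definition cycle_edges :: "nat list \<Rightarrow> nat set set" where
  "cycle_edges vs = {{vs ! i, vs ! (Suc i mod length vs)} | i. i < length vs}"

text \<open>
  A Hamiltonian cycle is represented by its edge set. The definition is only meaningful
  for \<open>n \<ge> 3\<close>.
\<close>

definition hamiltonian_cycle :: "nat \<Rightarrow> nat set set \<Rightarrow> bool" where
  "hamiltonian_cycle n H \<longleftrightarrow>
     (\<exists>vs. distinct vs \<and> set vs = verts n \<and> H = cycle_edges vs)"

definition TSPOPT :: "nat \<Rightarrow> (nat \<Rightarrow> real) \<Rightarrow> real" where
  "TSPOPT n c = Min {(\<Sum>e\<in>H. edge_cost n c e) | H. hamiltonian_cycle n H}"

definition cut :: "nat \<Rightarrow> nat set \<Rightarrow> nat set set" where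
  "cut n S = {e \<in> edges n. card (e \<inter> S) = 1}"

definition subtour_feasible :: "nat \<Rightarrow> (nat set \<Rightarrow> real) \<Rightarrow> bool" where
  "subtour_feasible n x \<longleftrightarrow>
     (\<forall>v\<in>verts n. (\<Sum>e\<in>cut n {v}. x e) = 2) \<and>
     (\<forall>S. S \<noteq> {} \<and> S \<subset> verts n \<longrightarrow> (\<Sum>e\<in>cut n S. x e) \<ge> 2) \<and>
     (\<forall>e\<in>edges n. 0 \<le> x e \<and> x e \<le> 1)"

definition LPOPT :: "nat \<Rightarrow> (nat \<Rightarrow> real) \<Rightarrow> real" where
  "LPOPT n c = Inf {(\<Sum>e\<in>edges n. edge_cost n c e * x e) | x. subtour_feasible n x}"

text \<open>
  The functions in \<open>stripe_costs n\<close> are extensional, so that they correspond exactly to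
  nonnegative real vectors with index set \<open>{1..n div 2}\<close>.
\<close>

definition stripe_costs :: "nat \<Rightarrow> (nat \<Rightarrow> real) set" where
  "stripe_costs n = {1..n div 2} \<rightarrow>\<^sub>E {0..}"

text \<open>
  The quotient is taken in the extended reals, where \<open>a / 0 = \<infinity>\<close> for \<open>a > 0\<close> and
  \<open>0 / 0 = 0\<close>. An instance with \<open>LPOPT = 0 < TSPOPT\<close> would therefore make the gap infinite,
  whereas an instance with both values \<open>0\<close> does not contribute to the supremum.
\<close>

definition gap_ratio :: "nat \<Rightarrow> (nat \<Rightarrow> real) \<Rightarrow> ereal" where
  "gap_ratio n c = ereal (TSPOPT n c) / ereal (LPOPT n c)"

end

theory Submission
  imports Defs
begin

text \<open>
  Upper bound. Start from the closed walk along multiples of the cheapest step and repeatedly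
  adjoin the cheapest step \<open>s\<close> outside the current subgroup \<open>g\<int>\<close>. The cosets of \<open>g\<int>\<close> in
  \<open>g'\<int>\<close>, \<open>g' = gcd g s\<close>, all carry translates of the same tour, and these can be merged
  using \<open>2 (g - g')\<close> edges of cost \<open>c\<^sub>s\<close> in total. On the other hand, summing the cut
  constraints over the cosets of \<open>g\<int>\<close> shows that a subtour solution puts weight at least
  \<open>g\<close> on the edges between them, all of which cost at least \<open>c\<^sub>s\<close>. Telescoping gives
  \<open>TSPOPT \<le> 2 LPOPT\<close>.

  Lower bound. Let \<open>n = 2h\<close> with \<open>h\<close> even, and let the stripes \<open>h\<close>, \<open>1\<close> and all others cost
  \<open>0\<close>, \<open>1\<close> and \<open>n\<close>. On this Moebius ladder the LP can take every rung with weight \<open>1\<close> and every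
  ring edge with weight \<open>1/2\<close>, for a total cost of \<open>h\<close>. By parity a tour of cost less than
  \<open>n\<close> uses both or none of any two antipodal ring edges, and it omits at most one such pair, as
  otherwise it would be disconnected. So it costs at least \<open>2 (h - 1)\<close>.
\<close>

section \<open>Merging the cosets of a closed tour\<close>

fun path_cost :: "(int \<Rightarrow> real) \<Rightarrow> int list \<Rightarrow> real" where
  "path_cost f (x # y # zs) = f (y - x) + path_cost f (y # zs)"
| "path_cost f _ = 0"

definition tour_cost :: "(int \<Rightarrow> real) \<Rightarrow> int list \<Rightarrow> real" where
  "tour_cost f xs = path_cost f xs + f (hd xs - last xs)"

lemma path_cost_append:
  "xs \<noteq> [] \<Longrightarrow> ys \<noteq> [] \<Longrightarrow>
     path_cost f (xs @ ys) = path_cost f xs + f (hd ys - last xs) + path_cost f ys"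
proof (induction xs)
  case (Cons x xs)
  then show ?case by (cases xs; cases ys) auto
qed simp

lemma path_cost_shift: "path_cost f (map (\<lambda>x. x + a) xs) = path_cost f xs"
  by (induction f xs rule: path_cost.induct) auto

lemma path_cost_rev:
  assumes "\<And>z. f (- z) = f z"
  shows "path_cost f (rev xs) = path_cost f xs"
proof (induction xs)
  case (Cons x xs)
  show ?case
  proof (cases xs)
    case (Cons y ys)
    have "path_cost f (rev (x # xs)) = path_cost f (rev xs) + f (x - last (rev xs))"
      using path_cost_append[of "rev xs" "[x]" f] Cons by simp
    also have "\<dots> = path_cost f (x # xs)"
      using Cons.IH Cons assms[of "y - x"] by (simp add: last_rev)
    finally show ?thesis .
  qed simp
qed simp

lemma path_cost_nth:
  "path_cost f xs = (\<Sum>i<length xs - 1. f (xs ! Suc i - xs ! i))"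
  by (induction f xs rule: path_cost.induct) (auto simp: sum.lessThan_Suc_shift simp del: sum.lessThan_Suc)

text \<open>The closing edge is the last index, whose successor wraps to 0; this is the indexing of
  \<open>cycle_edges\<close>.\<close>

lemma tour_cost_nth:
  assumes "xs \<noteq> []"
  shows "tour_cost f xs = (\<Sum>i<length xs. f (xs ! (Suc i mod length xs) - xs ! i))"
proof -
  obtain k where k: "length xs = Suc k" using assms by (cases xs) auto
  have "(\<Sum>i<length xs. f (xs ! (Suc i mod length xs) - xs ! i)) =
        (\<Sum>i<k. f (xs ! (Suc i mod length xs) - xs ! i)) + f (xs ! 0 - xs ! k)"
    by (simp add: k)
  also have "(\<Sum>i<k. f (xs ! (Suc i mod length xs) - xs ! i)) = path_cost f xs"
    unfolding path_cost_nth by (intro sum.cong) (auto simp: k)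
  finally show ?thesis using assms by (simp add: tour_cost_def hd_conv_nth last_conv_nth k)
qed

text \<open>A boustrophedon: odd copies of \<open>w\<close> run backwards, so consecutive copies
  meet in translates of the same end of \<open>w\<close> and each link is a single step
  \<open>s\<close>.\<close>

fun snake :: "int list \<Rightarrow> int \<Rightarrow> nat \<Rightarrow> int list" where
  "snake w s 0 = w"
| "snake w s (Suc k) =
     snake w s k @ map (\<lambda>x. x + int (Suc k) * s) (if even k then rev w else w)"

lemma length_snake: "length (snake w s k) = Suc k * length w"
  by (induction k) auto

lemma set_snake: "set (snake w s k) = (\<Union>i\<le>k. (\<lambda>x. x + int i * s) ` set w)"
  by (induction k) (auto simp: atMost_Suc)

lemma hd_snake: "w \<noteq> [] \<Longrightarrow> snake w s k \<noteq> [] \<and> hd (snake w s k) = hd w"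
  by (induction k) (auto simp: hd_append)

lemma last_snake:
  "w \<noteq> [] \<Longrightarrow> last (snake w s k) = (if even k then last w else hd w) + int k * s"
  by (induction k) (auto simp: last_map last_rev)

lemma path_cost_snake:
  assumes "\<And>z. f (- z) = f z" "w \<noteq> []"
  shows "path_cost f (snake w s k) = real (Suc k) * path_cost f w + real k * f s"
proof (induction k)
  case (Suc k)
  have "hd (map (\<lambda>x. x + int (Suc k) * s) (if even k then rev w else w)) - last (snake w s k) = s"
    using assms(2) by (auto simp: last_snake hd_map hd_rev algebra_simps)
  then show ?case using assms hd_snake[OF assms(2)] Suc
    by (simp add: path_cost_append path_cost_shift path_cost_rev algebra_simps)
qed simp

definition lane :: "int \<Rightarrow> int \<Rightarrow> nat \<Rightarrow> int list" where
  "lane q s k = map (\<lambda>i. q + int i * s) (rev [0..<Suc k])"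

lemma hd_lane: "hd (lane q s k) = q + int k * s"
  and last_lane: "last (lane q s k) = q"
  and lane_not_Nil: "lane q s k \<noteq> []"
  by (auto simp: lane_def last_map last_rev hd_map simp del: upt_Suc) auto

lemma length_lane: "length (lane q s k) = Suc k"
  by (simp add: lane_def)

lemma set_lane: "set (lane q s k) = (\<lambda>i. q + int i * s) ` {..k}"
  unfolding lane_def by (simp only: set_map set_rev set_upt) (simp add: atLeast0LessThan lessThan_Suc_atMost)

lemma path_cost_lane:
  assumes "\<And>z. f (- z) = f z"
  shows "path_cost f (lane q s k) = real k * f s"
proof (induction k)
  case (Suc k)
  have "lane q s (Suc k) = [q + int (Suc k) * s] @ lane q s k"
    by (simp add: lane_def)
  moreover have "hd (lane q s k) - (q + int (Suc k) * s) = - s"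
    by (simp add: hd_lane algebra_simps)
  ultimately have "path_cost f (lane q s (Suc k)) = f (- s) + path_cost f (lane q s k)"
    using path_cost_append[of "[q + int (Suc k) * s]" "lane q s k" f] lane_not_Nil by simp
  then show ?case using Suc assms by (simp add: algebra_simps)
qed (simp add: lane_def)

text \<open>The cosets of a closed tour are merged by a snake through all its vertices except
  one and a return lane through the translates of that vertex.\<close>

lemma tour_cost_snake_lane:
  assumes even: "\<And>z. f (- z) = f z" and low: "\<And>z. low \<le> f z" and w: "w \<noteq> []"
  shows "tour_cost f (snake w s k @ lane q s k) \<le>
           real (Suc k) * tour_cost f (q # w) + 2 * real k * (f s - low)"
proof -
  define a b where "a = f (hd w - q)" and "b = f (q - last w)"
  have ab: "low \<le> a" "low \<le> b" using low by (auto simp: a_def b_def)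
  have full: "tour_cost f (q # w) = path_cost f w + a + b"
    using w path_cost_append[of "[q]" w f] by (simp add: tour_cost_def a_def b_def)
  \<comment> \<open>The link from snake to lane: depending on the parity of \<open>k\<close>, the
    snake ends at a translate of \<open>last w\<close> or of \<open>hd w\<close>.\<close>
  define e where "e = f (q + int k * s - last (snake w s k))"
  have "tour_cost f (snake w s k @ lane q s k) =
          path_cost f (snake w s k) + e + path_cost f (lane q s k) + a"
    using hd_snake[OF w] lane_not_Nil
    by (simp add: tour_cost_def path_cost_append hd_lane last_lane a_def e_def)
  also have "\<dots> = real (Suc k) * path_cost f w + 2 * real k * f s + e + a"
    using even w by (simp add: path_cost_snake path_cost_lane)
  finally have cost: "tour_cost f (snake w s k @ lane q s k) =
    real (Suc k) * path_cost f w + 2 * real k * f s + e + a" .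
  have kab: "real k * low \<le> real k * a" "real k * low \<le> real k * b"
    using ab by (auto intro: mult_left_mono)
  have e: "e = (if even k then b else a)"
    using even[of "hd w - q"] w by (simp add: e_def last_snake a_def b_def)
  \<comment> \<open>It remains to see that
    \<open>e + a + 2 * k * low \<le> (k + 1) * (a + b)\<close>. After cancelling
    \<open>e + a\<close>, exactly \<open>2 * k\<close> summands \<open>a\<close> or \<open>b\<close>
    are left on the right, each at least \<open>low\<close>.\<close>
  show ?thesis
  proof (cases "even k")
    case True
    then show ?thesis using cost full kab e by (simp add: algebra_simps)
  next
    case False
    then obtain j where j: "k = Suc j" by (cases k) auto
    have "real j * low \<le> real j * a" using ab by (auto intro: mult_left_mono)
    then show ?thesis using cost full kab e False ab by (simp add: algebra_simps j)
  qed
qed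

section \<open>Tours versus coset weights\<close>

locale circulant =
  fixes n :: int and f :: "int \<Rightarrow> real" and low :: real
  assumes n_pos: "0 < n"
    and f_neg: "f (- z) = f z"
    and f_mod: "f (z mod n) = f z"
    and low_nonneg: "0 \<le> low"
    and low_le: "low \<le> f z"
begin

text \<open>There are \<open>n / g\<close> multiples of \<open>g\<close> modulo \<open>n\<close>, so
  covering them with a list of that length forces each residue to be visited exactly once.\<close>

definition coset_tour :: "int \<Rightarrow> int list \<Rightarrow> bool" where
  "coset_tour g xs \<longleftrightarrow>
     int (length xs) * g = n \<and> (\<forall>z. g dvd z \<longrightarrow> (\<exists>x\<in>set xs. n dvd z - x))"

text \<open>The translates by \<open>0, s, ..., k * s\<close> represent the cosets to be merged.
  Scaling each tour by its modulus turns \<open>d * Suc k\<close> into \<open>g\<close> and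
  \<open>d * k\<close> into \<open>g - d\<close>, so that the estimate telescopes.\<close>

lemma coset_tour_merge:
  assumes g: "0 < g" "g < n" and s: "\<not> g dvd s" and xs: "coset_tour g xs"
  shows "\<exists>ys. coset_tour (gcd g s) ys \<and>
    gcd g s * tour_cost f ys \<le> g * tour_cost f xs + 2 * (real_of_int g - gcd g s) * (f s - low)"
proof -
  define d where "d = gcd g s"
  define k where "k = nat (g div d) - 1"
  have d: "0 < d" "d dvd g" "d dvd s" using g by (auto simp: d_def)
  have gd: "0 < g div d" using d g by (meson pos_imp_zdiv_pos_iff zdvd_imp_le)
  then have k: "int (Suc k) * d = g" using d by (simp add: k_def)
  have len: "int (length xs) * g = n" using xs by (simp add: coset_tour_def)
  have "xs \<noteq> []" using len g by auto
  then obtain q w where xs_eq: "xs = q # w" by (cases xs) auto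
  have w: "w \<noteq> []" using len g by (auto simp: xs_eq)
  define ys where "ys = snake w s k @ lane q s k"
  have set_ys: "set ys = (\<Union>i\<le>k. (\<lambda>x. x + int i * s) ` set xs)"
    by (auto simp: ys_def set_snake set_lane xs_eq)
  have "length ys = Suc k * length xs"
    by (simp add: ys_def length_snake length_lane xs_eq)
  then have len_ys: "int (length ys) * d = n"
    using k len by (metis mult.assoc mult.commute of_nat_mult)
  have "\<exists>y\<in>set ys. n dvd z - y" if z: "d dvd z" for z
  proof -
    obtain u v where uv: "u * g + v * s = d" using bezout_int[of g s] by (auto simp: d_def)
    obtain t where t: "z = d * t" using z by auto
    define r where "r = g div d"
    \<comment> \<open>Bezout gives \<open>z \<equiv> v * t * s\<close> modulo \<open>g\<close>. The
      factor of \<open>s\<close> matters only modulo \<open>r\<close>, since \<open>r * s\<close> is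
      a multiple of \<open>g\<close>.\<close>
    define i where "i = nat ((v * t) mod r)"
    have r: "0 < r" "g = d * r" using gd d by (auto simp: r_def)
    have i_int: "int i = (v * t) mod r" using r by (simp add: i_def)
    have "int i < int (Suc k)"
      using k r d i_int pos_mod_bound[of r "v * t"] by (auto simp: mult.commute[of d])
    then have ik: "i \<le> k" by simp
    obtain s' where s': "s = d * s'" using d by auto
    have "z - int i * s = t * (u * g + v * s) - (v * t - r * (v * t div r)) * s"
      by (simp add: t uv i_int minus_mult_div_eq_mod)
    also have "\<dots> = g * (t * u + (v * t div r) * s')"
      by (simp add: r(2) s' algebra_simps)
    finally have "g dvd z - int i * s" by simp
    then obtain x where x: "x \<in> set xs" "n dvd z - int i * s - x"
      using xs by (auto simp: coset_tour_def)
    have "x + int i * s \<in> set ys" using x ik by (auto simp: set_ys)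
    moreover have "n dvd z - (x + int i * s)" using x by (simp add: algebra_simps)
    ultimately show ?thesis by blast
  qed
  then have "coset_tour d ys" using len_ys by (simp add: coset_tour_def)
  moreover have "d * tour_cost f ys \<le> g * tour_cost f xs + 2 * (real_of_int g - d) * (f s - low)"
  proof -
    have "tour_cost f ys \<le> real (Suc k) * tour_cost f xs + 2 * real k * (f s - low)"
      using tour_cost_snake_lane[of f low w s k q] f_neg low_le w by (simp add: ys_def xs_eq)
    then have "d * tour_cost f ys \<le>
        d * (real (Suc k) * tour_cost f xs + 2 * real k * (f s - low))"
      using d by (intro mult_left_mono) auto
    also have "\<dots> = g * tour_cost f xs + 2 * (real_of_int g - d) * (f s - low)"
      by (simp add: k[symmetric] algebra_simps)
    finally show ?thesis .
  qed
  ultimately show ?thesis unfolding d_def[symmetric] by (intro exI[of _ ys] conjI)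
qed

text \<open>By periodicity a minimum over the residues modulo \<open>n\<close> suffices; as
  \<open>g\<close> divides \<open>n\<close>, reduction preserves non-divisibility by
  \<open>g\<close>.\<close>

lemma cheapest_step:
  assumes g: "1 < g" "g dvd n"
  obtains s where "\<not> g dvd s" "\<And>t. \<not> g dvd t \<Longrightarrow> f s \<le> f t"
proof -
  define A where "A = {t \<in> {0..<n}. \<not> g dvd t}"
  have "g \<le> n" using g n_pos by (simp add: zdvd_imp_le)
  then have "1 \<in> A" using g by (auto simp: A_def)
  moreover have fin: "finite A" by (rule finite_subset[of _ "{0..<n}"]) (auto simp: A_def)
  ultimately obtain s where s: "s \<in> A" "\<And>t. t \<in> A \<Longrightarrow> f s \<le> f t"
    by (metis arg_min_if_finite(1,2) empty_iff linorder_not_less)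
  have "f s \<le> f t" if "\<not> g dvd t" for t
  proof -
    have "t mod n \<in> A" using that g n_pos by (simp add: A_def dvd_mod_iff)
    then show ?thesis using s(2) f_mod by metis
  qed
  then show thesis using s(1) that by (auto simp: A_def)
qed

text \<open>\<^term>\<open>X g\<close> and \<^term>\<open>F g\<close> stand for the total weight and the total cost of a
  subtour solution on the edges that join distinct cosets of \<open>g\<int>\<close>. Assumption \<open>X_ge\<close>
  is the cut constraint, summed over the cosets of \<open>g\<int>\<close>.\<close>

lemma tour_from_coset_tour:
  fixes X F :: "int \<Rightarrow> real"
  assumes X1: "X 1 = 0" "F 1 = 0"
    and X_ge: "\<And>g. 1 < g \<Longrightarrow> g dvd n \<Longrightarrow> g \<le> X g"
    and F_ge: "\<And>g d m. 1 < g \<Longrightarrow> g dvd n \<Longrightarrow> 0 < d \<Longrightarrow> d dvd g \<Longrightarrow>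
       (\<And>t. \<not> g dvd t \<Longrightarrow> m \<le> f t) \<Longrightarrow> (X g - X d) * m + F d \<le> F g"
  shows "\<lbrakk>0 < g; g dvd n; g < n; coset_tour g xs; 0 \<le> m; \<And>t. \<not> g dvd t \<Longrightarrow> m \<le> f t\<rbrakk> \<Longrightarrow>
     \<exists>ys. coset_tour 1 ys \<and>
       tour_cost f ys \<le> g * tour_cost f xs + 2 * (F g - (X g - g) * m) - 2 * (real_of_int g - 1) * low"
proof (induction "nat g" arbitrary: g xs m rule: less_induct)
  case less
  show ?case
  proof (cases "g = 1")
    case True
    then show ?thesis using less.prems X1 by (intro exI[of _ xs]) auto
  next
    case False
    then have g1: "1 < g" using less.prems by simp
    obtain s where s: "\<not> g dvd s" "\<And>t. \<not> g dvd t \<Longrightarrow> f s \<le> f t"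
      using cheapest_step g1 less.prems by blast
    define d where "d = gcd g s"
    have d: "0 < d" "d dvd g" using g1 by (auto simp: d_def)
    have "d \<noteq> g" using s(1) by (metis d_def gcd_dvd2)
    then have dg: "d < g" using d g1 by (meson order_less_le zdvd_imp_le zero_less_one order_less_trans)
    obtain xs' where xs': "coset_tour d xs'"
      "d * tour_cost f xs' \<le> g * tour_cost f xs + 2 * (real_of_int g - d) * (f s - low)"
      using coset_tour_merge[of g s xs] less.prems s(1) by (auto simp: d_def)
    have fs: "f s \<le> f t" if "\<not> d dvd t" for t using s(2) that d dvd_trans by blast
    have fs0: "0 \<le> f s" using low_le low_nonneg order_trans by blast
    \<comment> \<open>The induction hypothesis is used with \<open>f s\<close> in the role of
      \<open>m\<close>. The bound is thus a summation by parts over nondecreasing step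
      costs.\<close>
    obtain ys where ys: "coset_tour 1 ys"
      "tour_cost f ys \<le> d * tour_cost f xs' + 2 * (F d - (X d - d) * f s) - 2 * (real_of_int d - 1) * low"
      using less.hyps[of d xs' "f s", OF _ d(1) _ _ xs'(1) fs0 fs] d dg less.prems
      by (auto intro: dvd_trans)
    have "(X g - X d) * f s + F d \<le> F g"
      using F_ge[of g d "f s"] g1 less.prems d s by blast
    \<comment> \<open>The excess weight \<open>X g - g\<close> is nonnegative, so charging it at
      \<open>f s\<close> instead of \<open>m\<close> only sharpens the bound.\<close>
    moreover have "(X g - g) * m \<le> (X g - g) * f s"
      using X_ge[of g] g1 less.prems s by (intro mult_left_mono) auto
    ultimately have "tour_cost f ys \<le>
        g * tour_cost f xs + 2 * (F g - (X g - g) * m) - 2 * (real_of_int g - 1) * low"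
      using ys(2) xs'(2) by (simp add: algebra_simps)
    then show ?thesis using ys(1) by (intro exI[of _ ys] conjI)
  qed
qed

text \<open>The walk along the multiples of a cheapest step has scaled cost \<open>n * low\<close>.
  The weight \<open>X n \<ge> n\<close> gives back \<open>2 * n * low\<close>, and
  \<open>n \<ge> 2\<close> covers the remaining \<open>2 * low\<close>.\<close>

lemma tour_le_twice_lp:
  fixes X F :: "int \<Rightarrow> real"
  assumes n2: "2 \<le> n" and X1: "X 1 = 0" "F 1 = 0"
    and X_ge: "\<And>g. 1 < g \<Longrightarrow> g dvd n \<Longrightarrow> g \<le> X g"
    and F_ge: "\<And>g d m. 1 < g \<Longrightarrow> g dvd n \<Longrightarrow> 0 < d \<Longrightarrow> d dvd g \<Longrightarrow>
       (\<And>t. \<not> g dvd t \<Longrightarrow> m \<le> f t) \<Longrightarrow> (X g - X d) * m + F d \<le> F g"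
    and s: "\<not> n dvd s" "f s = low"
  shows "\<exists>ys. coset_tour 1 ys \<and> tour_cost f ys \<le> 2 * F n"
proof -
  define g where "g = gcd n s"
  define k where "k = nat (n div g) - 1"
  have g: "0 < g" "g dvd n" "g dvd s" using n2 by (auto simp: g_def)
  have "g \<noteq> n" using s(1) by (metis g_def gcd_dvd2)
  then have gn: "g < n" using g n2 by (meson order_less_le zdvd_imp_le n_pos)
  have ng: "0 < n div g" using g n_pos by (meson pos_imp_zdiv_pos_iff zdvd_imp_le)
  then have k: "int (Suc k) * g = n" using g by (simp add: k_def)
  define xs where "xs = lane 0 s k"
  have "\<exists>x\<in>set xs. n dvd z - x" if z: "g dvd z" for z
  proof -
    obtain u v where uv: "u * n + v * s = g" using bezout_int[of n s] by (auto simp: g_def)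
    obtain t where t: "z = g * t" using z by auto
    obtain s' where s': "s = g * s'" using g by auto
    define r where "r = n div g"
    define i where "i = nat ((v * t) mod r)"
    have r: "0 < r" "n = g * r" using ng g by (auto simp: r_def)
    have i_int: "int i = (v * t) mod r" using r by (simp add: i_def)
    have "int i < int (Suc k)"
      using k r g i_int pos_mod_bound[of r "v * t"] by (auto simp: mult.commute[of g])
    then have "int i * s \<in> set xs" by (auto simp: xs_def set_lane)
    moreover have "z - int i * s = t * (u * n + v * s) - (v * t - r * (v * t div r)) * s"
      by (simp add: t uv i_int minus_mult_div_eq_mod)
    then have "z - int i * s = n * (t * u + (v * t div r) * s')"
      by (simp add: r(2) s' algebra_simps)
    ultimately show ?thesis by (metis dvd_triv_left)
  qed
  moreover have "length xs = Suc k" by (simp add: xs_def length_lane)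
  ultimately have xs: "coset_tour g xs" using k by (simp add: coset_tour_def)
  have "tour_cost f xs = real k * f s + f (int k * s)"
    by (simp add: tour_cost_def xs_def path_cost_lane f_neg hd_lane last_lane)
  \<comment> \<open>\<open>Suc k * s\<close> is a multiple of \<open>n\<close>, so the closing edge
    is the step \<open>- s\<close> modulo \<open>n\<close>.\<close>
  also have "f (int k * s) = f s"
  proof -
    have "int k * s + s = int (Suc k) * g * (s div g)"
      using g by (simp add: mult.assoc algebra_simps)
    then have "int k * s = - s + n * (s div g)" using k by simp
    then have "(int k * s) mod n = (- s) mod n" by (simp only: mod_mult_self2)
    then show ?thesis using f_mod f_neg by metis
  qed
  finally have "tour_cost f xs = real (Suc k) * low" using s(2) by (simp add: algebra_simps)
  moreover have "real_of_int n = real (Suc k) * g"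
    using k by (metis of_int_mult of_int_of_nat_eq)
  ultimately have cost: "g * tour_cost f xs = n * low" by simp
  obtain ys where ys: "coset_tour 1 ys"
    "tour_cost f ys \<le> g * tour_cost f xs + 2 * (F g - (X g - g) * low) - 2 * (real_of_int g - 1) * low"
  proof -
    have "\<exists>ys. coset_tour 1 ys \<and>
      tour_cost f ys \<le> g * tour_cost f xs + 2 * (F g - (X g - g) * low) - 2 * (real_of_int g - 1) * low"
      by (rule tour_from_coset_tour[where X = X and F = F, OF X1])
        (fact X_ge F_ge g gn xs low_nonneg | rule low_le)+
    then show thesis using that by blast
  qed
  have "(X n - X g) * low + F g \<le> F n" using F_ge[of n g low] n2 g low_le by auto
  moreover have "n * low \<le> X n * low" using X_ge[of n] n2 low_nonneg by (intro mult_right_mono) auto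
  moreover have "2 * low \<le> n * low" using n2 low_nonneg by (intro mult_right_mono) auto
  ultimately have "tour_cost f ys \<le> 2 * F n"
    using ys(2) cost by (simp add: algebra_simps)
  then show ?thesis using ys(1) by blast
qed

end

section \<open>The subtour LP bound\<close>

definition edge_diff :: "nat set \<Rightarrow> int" where
  "edge_diff e = int (Max e) - int (Min e)"

lemma edge_diff_doubleton: "i < j \<Longrightarrow> edge_diff {i, j} = int j - int i"
  by (simp add: edge_diff_def)

lemma edges_cases:
  assumes "e \<in> edges n"
  obtains i j where "1 \<le> i" "i < j" "j \<le> n" "e = {i, j}"
proof -
  obtain a b where ab: "a \<in> verts n" "b \<in> verts n" "a \<noteq> b" "e = {a, b}"
    using assms by (auto simp: edges_def)
  show thesis
  proof (cases "a < b")
    case True then show ?thesis using ab that[of a b] by (auto simp: verts_def)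
  next
    case False then show ?thesis using ab that[of b a] by (auto simp: verts_def insert_commute)
  qed
qed

lemma doubleton_in_edges: "{i, j} \<in> edges n \<longleftrightarrow> i \<in> verts n \<and> j \<in> verts n \<and> i \<noteq> j"
  unfolding edges_def by (auto simp: doubleton_eq_iff)

lemma finite_edges: "finite (edges n)"
proof -
  have "edges n \<subseteq> Pow (verts n)" by (auto simp: edges_def)
  then show ?thesis by (rule finite_subset) (simp add: verts_def)
qed

lemma edge_diff_not_dvd: "e \<in> edges n \<Longrightarrow> \<not> int n dvd edge_diff e"
  by (elim edges_cases) (auto simp: edge_diff_doubleton dest!: zdvd_imp_le)

lemma card_doubleton_Int_eq_1:
  "i \<noteq> j \<Longrightarrow> card ({i, j} \<inter> S) = 1 \<longleftrightarrow> (i \<in> S) \<noteq> (j \<in> S)"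
  by (auto simp: Int_insert_left)

lemma doubleton_in_cut:
  "{i, j} \<in> cut n S \<longleftrightarrow> {i, j} \<in> edges n \<and> (i \<in> S) \<noteq> (j \<in> S)"
  using card_doubleton_Int_eq_1[of i j S] by (auto simp: cut_def doubleton_in_edges)

definition cross_edges :: "nat \<Rightarrow> int \<Rightarrow> nat set set" where
  "cross_edges n g = {e \<in> edges n. \<not> g dvd edge_diff e}"

lemma finite_cross_edges: "finite (cross_edges n g)"
  using finite_edges by (auto simp: cross_edges_def intro: finite_subset[OF _ finite_edges])

lemma cross_edges_1: "cross_edges n 1 = {}"
  by (simp add: cross_edges_def)

lemma cross_edges_self: "cross_edges n (int n) = edges n"
  using edge_diff_not_dvd by (auto simp: cross_edges_def)

lemma cross_edges_mono: "d dvd g \<Longrightarrow> cross_edges n d \<subseteq> cross_edges n g"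
  unfolding cross_edges_def using dvd_trans by blast

text \<open>The cut constraints of the \<open>g\<close> residue classes add up to
  \<open>2 * g\<close>. An edge between two classes lies in exactly two of these cuts, an edge
  inside a class in none.\<close>

lemma cross_edges_weight_ge:
  assumes x: "subtour_feasible n x" and n: "0 < n" and g: "1 < g" "g dvd int n"
  shows "g \<le> (\<Sum>e\<in>cross_edges n g. x e)"
proof -
  define G where "G = nat g"
  have G: "g = int G" "1 < G" "G dvd n" using g by (auto simp: G_def int_dvd_int_iff[symmetric])
  have Gn: "G \<le> n" using G n by (simp add: dvd_imp_le)
  define V where "V r = {v \<in> verts n. v mod G = r}" for r
  have V_ne: "V r \<noteq> {}" if "r < G" for r
  \<comment> \<open>Vertices run from 1 to \<open>n\<close>, so the class of 0 is represented by
    \<open>n\<close>, a multiple of \<open>G\<close>.\<close>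
  proof (cases "r = 0")
    case True
    then have "n \<in> V r" using n G by (auto simp: V_def verts_def)
    then show ?thesis by auto
  next
    case False
    then have "r \<in> V r" using that Gn by (auto simp: V_def verts_def)
    then show ?thesis by auto
  qed
  have V_psub: "V r \<subset> verts n" if "r < G" for r
  proof -
    define r' where "r' = (if r = 0 then 1 else 0 :: nat)"
    have "V r' \<noteq> {}" using G by (intro V_ne) (auto simp: r'_def)
    then obtain v where "v \<in> verts n" "v mod G = r'" by (auto simp: V_def)
    then have "v \<in> verts n - V r" by (auto simp: V_def r'_def)
    then show ?thesis by (auto simp: V_def)
  qed
  have "2 * real G = (\<Sum>r<G. 2)" by simp
  also have "\<dots> \<le> (\<Sum>r<G. \<Sum>e\<in>cut n (V r). x e)"
    using x V_ne V_psub by (intro sum_mono) (auto simp: subtour_feasible_def)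
  also have "\<dots> = (\<Sum>r<G. \<Sum>e\<in>edges n. if card (e \<inter> V r) = 1 then x e else 0)"
    by (simp add: cut_def sum.inter_filter finite_edges)
  also have "\<dots> = (\<Sum>e\<in>edges n. \<Sum>r<G. if card (e \<inter> V r) = 1 then x e else 0)"
    by (rule sum.swap)
  also have "\<dots> = (\<Sum>e\<in>edges n. if \<not> g dvd edge_diff e then 2 * x e else 0)"
  proof (rule sum.cong)
    fix e assume e: "e \<in> edges n"
    then obtain i j where ij: "1 \<le> i" "i < j" "j \<le> n" "e = {i, j}" by (rule edges_cases)
    have dvd_iff: "g dvd edge_diff e \<longleftrightarrow> i mod G = j mod G"
      using ij by (simp add: edge_diff_doubleton G(1) mod_eq_dvd_iff[symmetric] zmod_int[symmetric] eq_commute)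
    have card_iff: "card (e \<inter> V r) = 1 \<longleftrightarrow> (i mod G = r) \<noteq> (j mod G = r)" for r
      using ij card_doubleton_Int_eq_1[of i j "V r"] by (simp add: V_def verts_def)
    have "(\<Sum>r<G. if card (e \<inter> V r) = 1 then x e else 0) =
        (\<Sum>r\<in>{r\<in>{..<G}. (i mod G = r) \<noteq> (j mod G = r)}. x e)"
      unfolding card_iff by (rule sum.inter_filter[symmetric]) simp
    also have "\<dots> = (if \<not> g dvd edge_diff e then 2 * x e else 0)"
    proof (cases "i mod G = j mod G")
      case False
      then have "{r\<in>{..<G}. (i mod G = r) \<noteq> (j mod G = r)} = {i mod G, j mod G}"
        using G by auto
      then show ?thesis using False dvd_iff by simp
    qed (use dvd_iff in simp)
    finally show "(\<Sum>r<G. if card (e \<inter> V r) = 1 then x e else 0) =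
      (if \<not> g dvd edge_diff e then 2 * x e else 0)" .
  qed simp
  also have "\<dots> = 2 * (\<Sum>e\<in>cross_edges n g. x e)"
    by (simp only: cross_edges_def sum.inter_filter[OF finite_edges, symmetric] sum_distrib_left)
  finally show ?thesis using G by simp
qed

section \<open>Step costs and vertices as residues modulo \<open>n\<close>\<close>

definition step_cost :: "nat \<Rightarrow> (nat \<Rightarrow> real) \<Rightarrow> int \<Rightarrow> real" where
  "step_cost n c z = c (nat (min (z mod int n) ((- z) mod int n)))"

lemma step_cost_neg: "step_cost n c (- z) = step_cost n c z"
  by (simp add: step_cost_def min.commute)

lemma step_cost_cong: "a mod int n = b mod int n \<Longrightarrow> step_cost n c a = step_cost n c b"
  unfolding step_cost_def by (metis mod_minus_eq)

lemma edge_cost_doubleton: "i \<noteq> j \<Longrightarrow> edge_cost n c {i, j} = step_cost n c (int j - int i)"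
proof (induction i j rule: linorder_less_wlog)
  case (less i j)
  then show ?case by (simp add: edge_cost_def circ_dist_def step_cost_def min.commute)
next
  case (sym i j)
  then show ?case
    using step_cost_neg[of n c "int j - int i"] by (simp add: insert_commute)
qed simp

lemma edge_cost_eq: "e \<in> edges n \<Longrightarrow> edge_cost n c e = step_cost n c (edge_diff e)"
  by (elim edges_cases) (simp add: edge_cost_doubleton edge_diff_doubleton)

text \<open>For \<open>z\<close> not divisible by \<open>n\<close> the residues of \<open>z\<close>
  and \<open>- z\<close> are positive and add up to \<open>n\<close>, so the smaller one is a
  genuine stripe index.\<close>

lemma step_cost_nonneg:
  assumes "0 < n" "\<And>k. k \<in> {1..n div 2} \<Longrightarrow> 0 \<le> c k" "\<not> int n dvd z"
  shows "0 \<le> step_cost n c z"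
proof -
  have z: "z mod int n \<noteq> 0" using assms(3) by (simp add: dvd_eq_mod_eq_0)
  have "(- z) mod int n = int n - z mod int n" using z by (simp add: zmod_zminus1_eq_if)
  moreover have "0 \<le> z mod int n" "z mod int n < int n" using assms(1) by simp_all
  moreover have "int (n div 2) = int n div 2" by simp
  ultimately have "nat (min (z mod int n) ((- z) mod int n)) \<in> {1..n div 2}"
    using z unfolding atLeastAtMost_iff by linarith
  then show ?thesis unfolding step_cost_def by (rule assms(2))
qed

definition vertex :: "nat \<Rightarrow> int \<Rightarrow> nat" where
  "vertex n z = Suc (nat (z mod int n))"

lemma vertex_in_verts: "0 < n \<Longrightarrow> vertex n z \<in> verts n"
  by (auto simp: vertex_def verts_def Suc_le_eq nat_less_iff)

lemma vertex_eq_iff: "0 < n \<Longrightarrow> vertex n a = vertex n b \<longleftrightarrow> int n dvd a - b"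
  by (auto simp: vertex_def mod_eq_dvd_iff[symmetric] nat_eq_iff2)

lemma vertex_surj:
  assumes "v \<in> verts n"
  shows "v = vertex n (int v - 1)"
  using assms by (auto simp: vertex_def verts_def)

lemma edge_cost_vertex:
  assumes "0 < n" "\<not> int n dvd b - a"
  shows "edge_cost n c {vertex n a, vertex n b} = step_cost n c (b - a)"
proof -
  have "vertex n a \<noteq> vertex n b"
    using assms vertex_eq_iff[of n b a] by auto
  then have "edge_cost n c {vertex n a, vertex n b} = step_cost n c (b mod int n - a mod int n)"
    using assms(1) by (subst edge_cost_doubleton) (auto simp: vertex_def)
  also have "\<dots> = step_cost n c (b - a)"
    by (rule step_cost_cong) (simp add: mod_diff_eq)
  finally show ?thesis .
qed

text \<open>This supplies \<open>F_ge\<close>: the edges crossing at level \<open>g\<close> but not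
  at \<open>d\<close> have nonnegative weight and cost at least \<open>m\<close> each.\<close>

lemma cross_edges_cost_ge:
  assumes x: "subtour_feasible n x" and dg: "d dvd g"
    and m: "\<And>e. e \<in> cross_edges n g \<Longrightarrow> m \<le> edge_cost n c e"
  shows "((\<Sum>e\<in>cross_edges n g. x e) - (\<Sum>e\<in>cross_edges n d. x e)) * m +
     (\<Sum>e\<in>cross_edges n d. edge_cost n c e * x e) \<le> (\<Sum>e\<in>cross_edges n g. edge_cost n c e * x e)"
proof -
  let ?D = "cross_edges n g - cross_edges n d"
  have diff: "sum y ?D = sum y (cross_edges n g) - sum y (cross_edges n d)" for y :: "nat set \<Rightarrow> real"
    by (rule sum_diff[OF finite_cross_edges cross_edges_mono[OF dg]])
  have "(\<Sum>e\<in>?D. m * x e) \<le> (\<Sum>e\<in>?D. edge_cost n c e * x e)"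
    using x m by (intro sum_mono mult_right_mono) (auto simp: subtour_feasible_def cross_edges_def)
  then show ?thesis by (simp add: diff sum_distrib_left[symmetric] algebra_simps)
qed

section \<open>Hamiltonian cycles and the upper bound\<close>

lemma cycle_edges_subset:
  assumes "distinct vs" "set vs = verts n" "2 \<le> n"
  shows "cycle_edges vs \<subseteq> edges n"
proof -
  have len: "length vs = n" using assms distinct_card[of vs] by (simp add: verts_def)
  have "{vs ! i, vs ! (Suc i mod n)} \<in> edges n" if i: "i < n" for i
  proof -
    have "Suc i mod n < n" "Suc i mod n \<noteq> i" using i assms(3) by (auto simp: mod_Suc)
    then show ?thesis using i len assms nth_mem[of i vs] nth_mem[of "Suc i mod n" vs]
      by (simp add: doubleton_in_edges nth_eq_iff_index_eq)
  qed
  then show ?thesis by (auto simp: cycle_edges_def len)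
qed

lemma hamiltonian_cycle_subset: "hamiltonian_cycle n H \<Longrightarrow> 2 \<le> n \<Longrightarrow> H \<subseteq> edges n"
  using cycle_edges_subset by (auto simp: hamiltonian_cycle_def)

lemma finite_tour_costs:
  assumes "2 \<le> n"
  shows "finite {(\<Sum>e\<in>H. edge_cost n c e) | H. hamiltonian_cycle n H}"
proof -
  have "{(\<Sum>e\<in>H. edge_cost n c e) | H. hamiltonian_cycle n H} \<subseteq>
      (\<lambda>H. \<Sum>e\<in>H. edge_cost n c e) ` Pow (edges n)"
    using hamiltonian_cycle_subset assms by auto
  then show ?thesis by (rule finite_subset) (simp add: finite_edges)
qed

lemma TSPOPT_le:
  "hamiltonian_cycle n H \<Longrightarrow> 2 \<le> n \<Longrightarrow> TSPOPT n c \<le> (\<Sum>e\<in>H. edge_cost n c e)"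
  unfolding TSPOPT_def using finite_tour_costs by (intro Min_le) auto

lemma TSPOPT_ge:
  assumes "2 \<le> n" "\<And>H. hamiltonian_cycle n H \<Longrightarrow> b \<le> (\<Sum>e\<in>H. edge_cost n c e)"
  shows "b \<le> TSPOPT n c"
proof -
  have "hamiltonian_cycle n (cycle_edges [1..<Suc n])"
    unfolding hamiltonian_cycle_def verts_def
    by (intro exI[of _ "[1..<Suc n]"]) (auto simp del: upt_Suc)
  then show ?thesis unfolding TSPOPT_def using finite_tour_costs assms
    by (subst Min_ge_iff) auto
qed

text \<open>The abstract bound is instantiated with the weight and the cost of \<open>x\<close> on
  \<open>cross_edges\<close>. A \<open>coset_tour 1\<close> lists all residues, and
  \<open>vertex\<close> turns it into a Hamiltonian cycle.\<close>

lemma TSPOPT_le_twice_feasible: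
  assumes n: "3 \<le> n" and c: "\<And>k. k \<in> {1..n div 2} \<Longrightarrow> 0 \<le> c k" and x: "subtour_feasible n x"
  shows "TSPOPT n c \<le> 2 * (\<Sum>e\<in>edges n. edge_cost n c e * x e)"
proof -
  define A where "A = {z \<in> {0..<int n}. \<not> int n dvd z}"
  have "1 \<in> A" using n by (auto simp: A_def)
  moreover have "finite A" by (rule finite_subset[of _ "{0..<int n}"]) (auto simp: A_def)
  ultimately obtain s where s: "s \<in> A" "\<And>t. t \<in> A \<Longrightarrow> step_cost n c s \<le> step_cost n c t"
    by (metis arg_min_if_finite(1,2) empty_iff linorder_not_less)
  define low where "low = step_cost n c s"
  have low: "low \<le> step_cost n c t" if "\<not> int n dvd t" for t
  proof -
    have "t mod int n \<in> A" using that n by (simp add: A_def dvd_mod_iff)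
    then have "low \<le> step_cost n c (t mod int n)" using s(2) by (simp add: low_def)
    then show ?thesis using step_cost_cong[of "t mod int n" n t c] by simp
  qed
  \<comment> \<open>\<^term>\<open>c 0\<close> is arbitrary, and steps divisible by \<^term>\<open>n\<close> are only met in the
    degenerate tours of the induction.\<close>
  define f where "f z = (if int n dvd z then low else step_cost n c z)" for z
  have s_nd: "\<not> int n dvd s" using s by (simp add: A_def)
  interpret circulant "int n" f low
  proof
    show "0 \<le> low" using step_cost_nonneg[of n c s] n c s_nd by (simp add: low_def)
    show "f (z mod int n) = f z" for z
      using step_cost_cong[of "z mod int n" n z c] by (simp add: f_def dvd_mod_iff)
  qed (use n low in \<open>auto simp: f_def step_cost_neg\<close>)
  have edge_cost_f: "edge_cost n c e = f (edge_diff e)" if "e \<in> edges n" for e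
    using that edge_diff_not_dvd by (simp add: f_def edge_cost_eq)
  obtain ys where ys: "coset_tour 1 ys"
    "tour_cost f ys \<le> 2 * (\<Sum>e\<in>cross_edges n (int n). edge_cost n c e * x e)"
  proof -
    have "\<exists>ys. coset_tour 1 ys \<and>
        tour_cost f ys \<le> 2 * (\<Sum>e\<in>cross_edges n (int n). edge_cost n c e * x e)"
    proof (rule tour_le_twice_lp[where X = "\<lambda>g. \<Sum>e\<in>cross_edges n g. x e"
          and F = "\<lambda>g. \<Sum>e\<in>cross_edges n g. edge_cost n c e * x e" and s = s])
      fix g d :: int and m :: real
      assume "d dvd g" and m: "\<And>t. \<not> g dvd t \<Longrightarrow> m \<le> f t"
      show "((\<Sum>e\<in>cross_edges n g. x e) - (\<Sum>e\<in>cross_edges n d. x e)) * m +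
        (\<Sum>e\<in>cross_edges n d. edge_cost n c e * x e) \<le> (\<Sum>e\<in>cross_edges n g. edge_cost n c e * x e)"
        using x \<open>d dvd g\<close>
        by (rule cross_edges_cost_ge) (use m edge_cost_f in \<open>auto simp: cross_edges_def\<close>)
    next
      show "f s = low" using s_nd by (simp add: f_def low_def)
    qed (use n x s_nd cross_edges_weight_ge in \<open>auto simp: cross_edges_1\<close>)
    then show thesis using that by blast
  qed
  define vs where "vs = map (vertex n) ys"
  have len: "length ys = n" "length vs = n" using ys(1) by (auto simp: coset_tour_def vs_def)
  have set_vs: "set vs = verts n"
  proof
    show "set vs \<subseteq> verts n" using n vertex_in_verts by (auto simp: vs_def)
    show "verts n \<subseteq> set vs"
    proof
      fix v assume v: "v \<in> verts n"
      obtain y where y: "y \<in> set ys" "int n dvd (int v - 1) - y"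
        using ys(1) by (auto simp: coset_tour_def)
      then have "vertex n (int v - 1) = vertex n y" using n by (simp add: vertex_eq_iff)
      then have "v = vertex n y" using vertex_surj[OF v] by simp
      then show "v \<in> set vs" using y by (auto simp: vs_def)
    qed
  qed
  have dist: "distinct vs" using len set_vs by (intro card_distinct) (simp add: verts_def)
  have ham: "hamiltonian_cycle n (cycle_edges vs)"
    using dist set_vs by (auto simp: hamiltonian_cycle_def)
  have sub: "cycle_edges vs \<subseteq> edges n" using cycle_edges_subset dist set_vs n by simp
  define E where "E i = {vs ! i, vs ! (Suc i mod n)}" for i
  have E: "cycle_edges vs = E ` {..<n}" by (auto simp: cycle_edges_def E_def len)
  have cost_E: "edge_cost n c (E i) = f (ys ! (Suc i mod n) - ys ! i)" if i: "i < n" for i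
  proof -
    define a b where "a = ys ! i" and "b = ys ! (Suc i mod n)"
    have Ei: "E i = {vertex n a, vertex n b}"
      using i len by (simp add: E_def a_def b_def vs_def)
    have "E i \<in> edges n" using E sub i by blast
    then have "\<not> int n dvd b - a"
      using n vertex_eq_iff[of n b a] unfolding Ei by (auto simp: doubleton_in_edges)
    then show ?thesis using n edge_cost_vertex by (simp add: f_def Ei a_def[symmetric] b_def[symmetric])
  qed
  have "TSPOPT n c \<le> (\<Sum>e\<in>E ` {..<n}. edge_cost n c e)"
    using TSPOPT_le[OF ham] n E by simp
  \<comment> \<open>Costs are nonnegative, so this holds even if \<open>E\<close> repeats an
    edge.\<close>
  also have "\<dots> \<le> (\<Sum>i<n. edge_cost n c (E i))"
    using sum_image_le[of "{..<n}" "edge_cost n c" E]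
    by (auto simp: cost_E o_def intro: order_trans[OF low_nonneg low_le])
  also have "\<dots> = (\<Sum>i<n. f (ys ! (Suc i mod n) - ys ! i))" by (simp add: cost_E)
  also have "\<dots> = tour_cost f ys"
    using tour_cost_nth[of ys f] len n by force
  also have "\<dots> \<le> 2 * (\<Sum>e\<in>edges n. edge_cost n c e * x e)"
    using ys(2) by (simp add: cross_edges_self)
  finally show ?thesis .
qed

text \<open>The edges at \<open>vs ! k\<close> are those indexed by \<open>k\<close> and by its
  cyclic predecessor \<open>p\<close>. They differ because \<open>k\<close> has distinct neighbours
  when \<open>n \<ge> 3\<close>.\<close>

lemma hamiltonian_cycle_degree:
  assumes H: "hamiltonian_cycle n H" and n: "3 \<le> n" and v: "v \<in> verts n"
  shows "card {e \<in> H. v \<in> e} = 2"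
proof -
  obtain vs where vs: "distinct vs" "set vs = verts n" "H = cycle_edges vs"
    using H by (auto simp: hamiltonian_cycle_def)
  have len: "length vs = n" using vs distinct_card[of vs] by (simp add: verts_def)
  define E where "E i = {vs ! i, vs ! (Suc i mod n)}" for i
  have HE: "H = E ` {..<n}" by (auto simp: vs(3) cycle_edges_def E_def len)
  obtain k where k: "k < n" "v = vs ! k" using v vs(2) len by (metis in_set_conv_nth)
  define p where "p = (if k = 0 then n - 1 else k - 1)"
  have p: "p < n" "Suc p mod n = k" using k n by (auto simp: p_def)
  have succ: "Suc i mod n < n" for i using n by simp
  have "v \<in> E i \<longleftrightarrow> i = k \<or> i = p" if i: "i < n" for i
  proof -
    have "v \<in> E i \<longleftrightarrow> k = i \<or> k = Suc i mod n"
      using vs(1) i k succ[of i] len by (auto simp: E_def nth_eq_iff_index_eq)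
    also have "k = Suc i mod n \<longleftrightarrow> i = p"
      using i k n by (auto simp: p_def mod_Suc)
    finally show ?thesis by auto
  qed
  then have "{e \<in> H. v \<in> e} = {E k, E p}" using k p by (auto simp: HE)
  moreover have "E k \<noteq> E p"
  proof -
    have "Suc k mod n \<noteq> p" using k n by (auto simp: p_def mod_Suc)
    then have "vs ! (Suc k mod n) \<noteq> vs ! p"
      using vs(1) p succ[of k] len by (simp add: nth_eq_iff_index_eq)
    then show ?thesis using p by (auto simp: E_def doubleton_eq_iff)
  qed
  ultimately show ?thesis by simp
qed

text \<open>Without a crossing edge, membership in \<open>S\<close> would be constant along the list
  and hence on all vertices.\<close>

lemma hamiltonian_cycle_crosses_cut:
  assumes H: "hamiltonian_cycle n H" and n: "2 \<le> n" and S: "S \<noteq> {}" "S \<subset> verts n"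
  shows "\<exists>e\<in>H. e \<in> cut n S"
proof (rule ccontr)
  assume no_cross: "\<not> (\<exists>e\<in>H. e \<in> cut n S)"
  obtain vs where vs: "distinct vs" "set vs = verts n" "H = cycle_edges vs"
    using H by (auto simp: hamiltonian_cycle_def)
  have len: "length vs = n" using vs distinct_card[of vs] by (simp add: verts_def)
  have step: "vs ! i \<in> S \<longleftrightarrow> vs ! Suc i \<in> S" if i: "Suc i < n" for i
  proof -
    have "\<exists>j. {vs ! i, vs ! Suc i} = {vs ! j, vs ! (Suc j mod n)} \<and> j < n"
      using i by (intro exI[of _ i]) simp
    then have "{vs ! i, vs ! Suc i} \<in> H" by (simp add: vs(3) cycle_edges_def len)
    then have "{vs ! i, vs ! Suc i} \<notin> cut n S" "{vs ! i, vs ! Suc i} \<in> edges n"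
      using no_cross hamiltonian_cycle_subset[OF H n] by blast+
    then show ?thesis by (simp add: doubleton_in_cut)
  qed
  have "i < n \<Longrightarrow> vs ! i \<in> S \<longleftrightarrow> vs ! 0 \<in> S" for i
    by (induction i) (use step in auto)
  then have "v \<in> S \<longleftrightarrow> vs ! 0 \<in> S" if "v \<in> verts n" for v
    using that vs(2) len by (metis in_set_conv_nth)
  then show False using S by blast
qed

lemma card_cut:
  assumes S: "S \<subseteq> verts n"
  shows "card (cut n S) = card S * (n - card S)"
proof -
  have fin: "finite (verts n)" "finite S" using S finite_subset by (auto simp: verts_def)
  have "cut n S = (\<lambda>(i, j). {i, j}) ` (S \<times> (verts n - S))"
  proof
    show "cut n S \<subseteq> (\<lambda>(i, j). {i, j}) ` (S \<times> (verts n - S))"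
    proof
      fix e assume e: "e \<in> cut n S"
      then have "e \<in> edges n" by (simp add: cut_def)
      then obtain i j where ij: "e = {i, j}" by (rule edges_cases)
      then show "e \<in> (\<lambda>(i, j). {i, j}) ` (S \<times> (verts n - S))"
        using e by (auto simp: doubleton_in_cut doubleton_in_edges image_iff doubleton_eq_iff)
    qed
  qed (use S in \<open>auto simp: doubleton_in_cut doubleton_in_edges\<close>)
  moreover have "inj_on (\<lambda>(i, j). {i, j}) (S \<times> (verts n - S))"
    by (auto simp: inj_on_def doubleton_eq_iff)
  ultimately have "card (cut n S) = card S * card (verts n - S)"
    by (simp add: card_image card_cartesian_product)
  then show ?thesis using S fin by (simp add: card_Diff_subset verts_def)
qed

text \<open>A feasible point is needed for the infimum in \<open>LPOPT\<close> to be over a nonempty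
  set. For the uniform one the cut constraints amount to
  \<open>(s - 1) * (n - s - 1) \<ge> 0\<close>.\<close>

lemma subtour_feasible_const:
  assumes n: "3 \<le> n"
  shows "subtour_feasible n (\<lambda>_. 2 / (real n - 1))"
  unfolding subtour_feasible_def
proof (intro conjI ballI allI impI)
  fix v assume "v \<in> verts n"
  then have "card (cut n {v}) = n - 1" by (simp add: card_cut)
  then show "(\<Sum>e\<in>cut n {v}. 2 / (real n - 1)) = 2" using n by (simp add: field_simps)
next
  fix S assume S: "S \<noteq> {} \<and> S \<subset> verts n"
  define s where "s = card S"
  have fin: "finite (verts n)" by (simp add: verts_def)
  have "s < n" using S psubset_card_mono[OF fin, of S] by (simp add: s_def verts_def)
  moreover have "1 \<le> s" using S fin finite_subset[of S] by (auto simp: s_def Suc_le_eq card_gt_0_iff)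
  ultimately have "0 \<le> (real s - 1) * (real n - real s - 1)" by (intro mult_nonneg_nonneg) auto
  then have "real n - 1 \<le> real s * (real n - real s)" by (simp add: algebra_simps)
  also have "\<dots> = real (card (cut n S))"
    using S \<open>s < n\<close> by (simp add: card_cut s_def[symmetric] of_nat_diff psubset_imp_subset)
  finally show "(\<Sum>e\<in>cut n S. 2 / (real n - 1)) \<ge> 2"
    using n by (simp add: field_simps)
qed (use n in auto)

lemma TSPOPT_le_twice_LPOPT:
  assumes n: "3 \<le> n" and c: "\<And>k. k \<in> {1..n div 2} \<Longrightarrow> 0 \<le> c k"
  shows "TSPOPT n c \<le> 2 * LPOPT n c"
proof -
  have "TSPOPT n c / 2 \<le> LPOPT n c"
    unfolding LPOPT_def
  proof (rule cInf_greatest)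
    show "{\<Sum>e\<in>edges n. edge_cost n c e * x e |x. subtour_feasible n x} \<noteq> {}"
      using subtour_feasible_const[OF n] by blast
  next
    fix y assume "y \<in> {\<Sum>e\<in>edges n. edge_cost n c e * x e |x. subtour_feasible n x}"
    then show "TSPOPT n c / 2 \<le> y"
      using TSPOPT_le_twice_feasible[where n = n and c = c, OF n c] by fastforce
  qed
  then show ?thesis by simp
qed

lemma edge_cost_nonneg:
  assumes "3 \<le> n" "\<And>k. k \<in> {1..n div 2} \<Longrightarrow> 0 \<le> c k" "e \<in> edges n"
  shows "0 \<le> edge_cost n c e"
  using assms step_cost_nonneg[of n c "edge_diff e"] edge_diff_not_dvd edge_cost_eq by simp

lemma TSPOPT_nonneg:
  assumes "3 \<le> n" "\<And>k. k \<in> {1..n div 2} \<Longrightarrow> 0 \<le> c k"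
  shows "0 \<le> TSPOPT n c"
proof (rule TSPOPT_ge)
  fix H assume "hamiltonian_cycle n H"
  then have "H \<subseteq> edges n" using hamiltonian_cycle_subset assms(1) by simp
  then show "0 \<le> (\<Sum>e\<in>H. edge_cost n c e)"
    using edge_cost_nonneg[where n = n and c = c, OF assms] by (intro sum_nonneg) blast
qed (use assms in simp)

lemma LPOPT_le:
  assumes "3 \<le> n" "\<And>k. k \<in> {1..n div 2} \<Longrightarrow> 0 \<le> c k" "subtour_feasible n x"
  shows "LPOPT n c \<le> (\<Sum>e\<in>edges n. edge_cost n c e * x e)"
  unfolding LPOPT_def
proof (rule cInf_lower)
  show "bdd_below {\<Sum>e\<in>edges n. edge_cost n c e * x e |x. subtour_feasible n x}"
  proof (rule bdd_belowI[of _ 0])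
    fix y assume "y \<in> {\<Sum>e\<in>edges n. edge_cost n c e * x e |x. subtour_feasible n x}"
    then obtain x where "subtour_feasible n x" "y = (\<Sum>e\<in>edges n. edge_cost n c e * x e)" by blast
    then show "0 \<le> y" using edge_cost_nonneg[where n = n and c = c, OF assms(1,2)]
      by (auto intro!: sum_nonneg mult_nonneg_nonneg simp: subtour_feasible_def)
  qed
qed (use assms(3) in blast)

lemma gap_ratio_le_2:
  assumes "3 \<le> n" "c \<in> stripe_costs n"
  shows "gap_ratio n c \<le> 2"
proof -
  have c: "0 \<le> c k" if "k \<in> {1..n div 2}" for k
    using assms(2) that by (auto simp: stripe_costs_def dest: PiE_mem)
  have le: "TSPOPT n c \<le> 2 * LPOPT n c" by (rule TSPOPT_le_twice_LPOPT[OF assms(1) c])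
  have nonneg: "0 \<le> TSPOPT n c" by (rule TSPOPT_nonneg[OF assms(1) c])
  show ?thesis
  proof (cases "LPOPT n c = 0")
    \<comment> \<open>Both optima vanish here, and the quotient has its default value 0.\<close>
    case True
    then have "TSPOPT n c = 0" using le nonneg by simp
    then show ?thesis by (simp add: gap_ratio_def)
  next
    case False
    then have "0 < LPOPT n c" using le nonneg by simp
    then have "gap_ratio n c = ereal (TSPOPT n c / LPOPT n c)"
      by (simp add: gap_ratio_def)
    also have "\<dots> \<le> ereal 2"
      using le \<open>0 < LPOPT n c\<close> by (simp add: field_simps)
    finally show ?thesis by simp
  qed
qed

section \<open>Moebius ladder instances\<close>

locale moebius_ladder =
  fixes n h :: nat
  assumes n_eq: "n = 2 * h" and h_even: "even h" and h_ge: "2 \<le> h"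
begin

definition ring :: "int \<Rightarrow> nat set" where
  "ring z = {vertex n z, vertex n (z + 1)}"

definition rung :: "int \<Rightarrow> nat set" where
  "rung z = {vertex n z, vertex n (z + int h)}"

lemma n_ge: "4 \<le> n" and n_pos: "0 < n"
  using n_eq h_ge by auto

lemma n_div_2: "n div 2 = h"
  by (simp add: n_eq)

lemma int_n: "int n = 2 * int h"
  by (simp add: n_eq)

lemma not_dvd: "0 < k \<Longrightarrow> k < int n \<Longrightarrow> \<not> int n dvd k"
  by (rule zdvd_not_zless)

lemma v_eq_iff: "vertex n a = vertex n b \<longleftrightarrow> int n dvd a - b"
  by (rule vertex_eq_iff[OF n_pos])

text \<open>These differences would have to vanish modulo \<open>n\<close> for ladder edges or their
  endpoints to coincide.\<close>

lemma not_dvd_consts: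
  "\<not> int n dvd 1" "\<not> int n dvd 2" "\<not> int n dvd int h" "\<not> int n dvd int h - 1"
  "\<not> int n dvd int h + 1"
  by (rule not_dvd; use h_ge int_n in linarith)+

lemma ring_eq_iff: "ring a = ring b \<longleftrightarrow> int n dvd a - b"
proof -
  have "\<not> (int n dvd a - (b + 1) \<and> int n dvd (a + 1) - b)"
  proof
    assume "int n dvd a - (b + 1) \<and> int n dvd (a + 1) - b"
    then have "int n dvd ((a + 1) - b) - (a - (b + 1))" using dvd_diff by blast
    then show False using not_dvd_consts by simp
  qed
  then show ?thesis by (auto simp: ring_def doubleton_eq_iff v_eq_iff)
qed

lemma rung_shift: "rung (z + int h) = rung z"
proof -
  have "vertex n (z + int h + int h) = vertex n z" by (simp add: v_eq_iff int_n)
  then show ?thesis by (auto simp: rung_def)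
qed

lemma rung_neq_ring: "rung a \<noteq> ring b"
proof
  assume "rung a = ring b"
  then consider "int n dvd a - b" "int n dvd (a + int h) - (b + 1)"
    | "int n dvd a - (b + 1)" "int n dvd (a + int h) - b"
    by (auto simp: rung_def ring_def doubleton_eq_iff v_eq_iff)
  then show False
  proof cases
    case 1
    then have "int n dvd ((a + int h) - (b + 1)) - (a - b)" using dvd_diff by blast
    then show False using not_dvd_consts by simp
  next
    case 2
    then have "int n dvd ((a + int h) - b) - (a - (b + 1))" using dvd_diff by blast
    then show False using not_dvd_consts by simp
  qed
qed

lemma ring_cong: "vertex n a = vertex n b \<Longrightarrow> ring a = ring b"
  by (simp add: ring_eq_iff v_eq_iff)

lemma rung_cong: "vertex n a = vertex n b \<Longrightarrow> rung a = rung b"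
  using v_eq_iff[of "a + int h" "b + int h"] v_eq_iff[of a b] by (simp add: rung_def)

lemma vertex_in_ring: "vertex n z \<in> ring w \<longleftrightarrow> ring w = ring z \<or> ring w = ring (z - 1)"
proof
  assume "vertex n z \<in> ring w"
  then consider "vertex n z = vertex n w" | "vertex n z = vertex n (w + 1)"
    by (auto simp: ring_def)
  then show "ring w = ring z \<or> ring w = ring (z - 1)"
  proof cases
    case 2
    then have "vertex n (z - 1) = vertex n w" by (simp add: v_eq_iff algebra_simps)
    then show ?thesis using ring_cong by metis
  qed (use ring_cong in metis)
qed (auto simp: ring_def)

lemma vertex_in_rung: "vertex n z \<in> rung w \<longleftrightarrow> rung w = rung z"
proof
  assume "vertex n z \<in> rung w"
  then consider "vertex n z = vertex n w" | "vertex n z = vertex n (w + int h)"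
    by (auto simp: rung_def)
  then show "rung w = rung z"
    using rung_cong rung_shift by cases metis+
qed (auto simp: rung_def)

lemma ring_in_edges: "ring z \<in> edges n" and rung_in_edges: "rung z \<in> edges n"
  using vertex_in_verts[OF n_pos] not_dvd_consts
  by (auto simp: ring_def rung_def doubleton_in_edges v_eq_iff dvd_minus_iff[of _ 1, symmetric]
      dvd_minus_iff[of _ "int h", symmetric] simp del: dvd_minus_iff zdvd1_eq)

text \<open>The price \<open>n\<close> exceeds the intended bound \<open>n - 2\<close>, so a single
  edge off the ladder already makes a tour expensive enough.\<close>

definition cost :: "nat \<Rightarrow> real" where
  "cost = (\<lambda>k\<in>{1..n div 2}. if k = 1 then 1 else if k = h then 0 else real n)"

lemma cost_in_stripe_costs: "cost \<in> stripe_costs n"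
  by (auto simp: cost_def stripe_costs_def)

lemma cost_nonneg: "k \<in> {1..n div 2} \<Longrightarrow> 0 \<le> cost k"
  by (auto simp: cost_def)

lemma cost_1: "cost 1 = 1" and cost_h: "cost h = 0"
  using h_ge by (auto simp: cost_def n_div_2)

lemma step_cost_1: "step_cost n cost 1 = 1"
proof -
  have "(- 1) mod int n = int n - 1" using n_ge by (simp add: zmod_zminus1_eq_if)
  then show ?thesis using n_ge cost_1 by (simp add: step_cost_def min_def)
qed

lemma step_cost_h: "step_cost n cost (int h) = 0"
proof -
  have "int h mod int n = int h" using h_ge int_n by simp
  moreover have "(- int h) mod int n = int h"
    using h_ge int_n by (simp add: zmod_zminus1_eq_if)
  ultimately show ?thesis using cost_h by (simp add: step_cost_def)
qed

lemma edge_cost_ring: "edge_cost n cost (ring z) = 1"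
  using edge_cost_vertex[OF n_pos, of "z + 1" z] step_cost_1 not_dvd_consts
  by (simp add: ring_def)

lemma edge_cost_rung: "edge_cost n cost (rung z) = 0"
  using edge_cost_vertex[OF n_pos, of "z + int h" z] step_cost_h not_dvd_consts
  by (simp add: rung_def)

lemma edge_cases:
  assumes e: "e \<in> edges n"
  obtains z where "e = ring z" | z where "e = rung z" | "edge_cost n cost e = real n"
proof -
  obtain i j where ij: "1 \<le> i" "i < j" "j \<le> n" "e = {i, j}" using e by (rule edges_cases)
  define d where "d = j - i"
  have d: "1 \<le> d" "d < n" using ij by (auto simp: d_def)
  have i: "i = vertex n (int i - 1)" and j: "j = vertex n (int j - 1)"
    using ij by (auto intro!: vertex_surj simp: verts_def)
  have jd: "int j = int i + int d" using ij by (simp add: d_def)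
  consider "d = 1" | "d = n - 1" | "d = h" | "d \<noteq> 1" "d \<noteq> n - 1" "d \<noteq> h" by blast
  then show thesis
  proof cases
    case 1
    then have "e = ring (int i - 1)" using i j jd ij(4) by (simp add: ring_def)
    then show thesis by (rule that)
  next
    \<comment> \<open>Here \<open>i = 1\<close> and \<open>j = n\<close>: the ring edge that wraps
      around, starting at position \<open>j - 1\<close>.\<close>
    case 2
    have "vertex n (int j) = vertex n (int i - 1)"
      using 2 d by (simp add: v_eq_iff jd of_nat_diff)
    then have "e = ring (int j - 1)" using i j ij(4) by (auto simp: ring_def)
    then show thesis by (rule that)
  next
    case 3
    then have "e = rung (int i - 1)" using i j jd ij(4) by (simp add: rung_def algebra_simps)
    then show thesis by (rule that)
  next
    case 4
    have "edge_cost n cost e = step_cost n cost (int d)"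
      using ij jd by (simp add: edge_cost_doubleton)
    also have "\<dots> = cost (nat (min (int d) (int n - int d)))"
      using d by (simp add: step_cost_def zmod_zminus1_eq_if)
    also have "nat (min (int d) (int n - int d)) = min d (n - d)"
      using d by linarith
    also have "cost \<dots> = real n"
    proof -
      have "1 \<le> min d (n - d)" "min d (n - d) \<le> h" "min d (n - d) \<noteq> 1" "min d (n - d) \<noteq> h"
        using d 4 n_eq by linarith+
      then show ?thesis by (simp add: cost_def n_div_2)
    qed
    finally show thesis by (rule that)
  qed
qed

end

section \<open>Parity and connectivity of tours on the ladder\<close>

context moebius_ladder
begin

definition layer :: "nat set set \<Rightarrow> int \<Rightarrow> nat" where
  "layer H z = of_bool (ring z \<in> H) + of_bool (ring (z + int h) \<in> H)"

text \<open>A tour without edges of cost \<open>n\<close> stays on the ladder, where a vertex meets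
  only two ring edges and a rung.\<close>

lemma tour_degree:
  assumes H: "hamiltonian_cycle n H" and cheap: "\<And>e. e \<in> H \<Longrightarrow> edge_cost n cost e \<noteq> real n"
  shows "of_bool (ring (z - 1) \<in> H) + of_bool (ring z \<in> H) + of_bool (rung z \<in> H) = (2 :: nat)"
proof -
  have sub: "H \<subseteq> edges n" using H n_ge by (intro hamiltonian_cycle_subset) auto
  have "{e \<in> H. vertex n z \<in> e} = H \<inter> {ring (z - 1), ring z, rung z}"
  proof
    show "{e \<in> H. vertex n z \<in> e} \<subseteq> H \<inter> {ring (z - 1), ring z, rung z}"
    proof
      fix e assume e: "e \<in> {e \<in> H. vertex n z \<in> e}"
      then have "e \<in> edges n" "edge_cost n cost e \<noteq> real n" using sub cheap by auto
      then show "e \<in> H \<inter> {ring (z - 1), ring z, rung z}"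
        using e by (cases rule: edge_cases) (auto simp: vertex_in_ring vertex_in_rung)
    qed
  qed (auto simp: vertex_in_ring vertex_in_rung)
  then have "card (H \<inter> {ring (z - 1), ring z, rung z}) = 2"
    using hamiltonian_cycle_degree[OF H _ vertex_in_verts[OF n_pos, of z]] n_ge by simp
  moreover have "ring (z - 1) \<noteq> ring z" using not_dvd_consts by (simp add: ring_eq_iff)
  ultimately show ?thesis using rung_neq_ring
    by (auto simp: Int_insert_right rung_neq_ring[symmetric] split: if_splits)
qed

text \<open>If one layer contained a single ring edge, then so would all layers; all rungs would
  be used and the ring edges would alternate, whence by parity of \<^term>\<open>h\<close> both edges of a
  layer are used or none.\<close>

lemma layer_neq_1:
  assumes H: "hamiltonian_cycle n H" and cheap: "\<And>e. e \<in> H \<Longrightarrow> edge_cost n cost e \<noteq> real n"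
  shows "layer H z \<noteq> 1"
proof
  assume z: "layer H z = 1"
  note deg = tour_degree[OF H cheap]
  \<comment> \<open>Adding the degrees at both ends of a rung counts the rung twice, so neighbouring
    layers have equal parity.\<close>
  have step: "layer H (w - 1) + layer H w + 2 * of_bool (rung w \<in> H) = 4" for w
    using deg[of w] deg[of "w + int h"] rung_shift[of w] by (simp add: layer_def algebra_simps)
  have layers: "layer H (z + int i) = 1" for i
  proof (induction i)
    case (Suc i)
    have "layer H (z + int (Suc i)) \<le> 2" by (simp add: layer_def)
    then show ?case using step[of "z + int (Suc i)"] Suc
      by (cases "rung (z + int (Suc i)) \<in> H") (auto simp: algebra_simps)
  qed (use z in simp)
  \<comment> \<open>Two neighbouring layers of size 1 force the rung between them, which leaves
    exactly one of the two ring edges at its end \<open>?w\<close>.\<close>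
  have flip: "ring (z + int (Suc i)) \<in> H \<longleftrightarrow> ring (z + int i) \<notin> H" for i
  proof -
    let ?w = "z + int (Suc i)"
    have w: "?w - 1 = z + int i" by simp
    have "rung ?w \<in> H"
      using step[of ?w] layers[of i] layers[of "Suc i"] unfolding w
      by (cases "rung ?w \<in> H") simp_all
    then show ?thesis
      using deg[of ?w] unfolding w
      by (cases "ring ?w \<in> H"; cases "ring (z + int i) \<in> H") simp_all
  qed
  have "ring (z + int i) \<in> H \<longleftrightarrow> (ring z \<in> H) = even i" for i
    by (induction i) (use flip in auto)
  then have "ring (z + int h) \<in> H \<longleftrightarrow> ring z \<in> H" using h_even by simp
  then show False using z by (auto simp: layer_def)
qed

text \<open>Modulo \<open>n = 2 * h\<close>, \<open>z\<close> is either \<open>z mod h\<close> or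
  \<open>z mod h + h\<close>, and the layer counts the ring edges at both.\<close>

lemma layer_mod:
  assumes "layer H (z mod int h) = 0"
  shows "ring z \<notin> H"
proof -
  define w where "w = z mod int n"
  have "int n dvd z - w" by (simp add: w_def)
  then have rw: "ring z = ring w" by (simp add: ring_eq_iff)
  have "0 \<le> w" "w < int n" using n_pos by (simp_all add: w_def)
  moreover have "w mod int h = z mod int h" by (simp add: w_def int_n mod_mod_cancel)
  ultimately have w: "0 \<le> w" "w < 2 * int h" "w mod int h = z mod int h"
    by (simp_all add: int_n)
  have "w = z mod int h \<or> w = z mod int h + int h"
  proof (cases "w < int h")
    case True then show ?thesis using w by auto
  next
    case False
    then have "(w - int h) mod int h = w - int h" using w by (intro mod_pos_pos_trivial) auto
    then show ?thesis using w by simp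
  qed
  then show ?thesis using assms rw by (auto simp: layer_def)
qed

text \<open>Two empty layers would disconnect the tour.\<close>

lemma empty_layer_unique:
  assumes H: "hamiltonian_cycle n H" and cheap: "\<And>e. e \<in> H \<Longrightarrow> edge_cost n cost e \<noteq> real n"
    and z: "0 \<le> z1" "z1 < z2" "z2 < int h" and empty: "layer H z1 = 0" "layer H z2 = 0"
  shows False
proof -
  \<comment> \<open>A rung keeps the position modulo \<open>h\<close>, so only ring edges of the
    empty layers \<open>z1\<close> and \<open>z2\<close> leave this set.\<close>
  define S where "S = {v \<in> verts n. (int v - 1) mod int h \<in> {z1<..z2}}"
  have vS: "vertex n w \<in> S \<longleftrightarrow> w mod int h \<in> {z1<..z2}" for w
  proof -
    have "int (vertex n w) - 1 = w mod int n" using n_pos by (simp add: vertex_def)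
    then have "(int (vertex n w) - 1) mod int h = w mod int h"
      by (simp add: int_n mod_mod_cancel)
    then show ?thesis using vertex_in_verts[OF n_pos] by (simp add: S_def)
  qed
  have "vertex n z2 \<in> S" "vertex n z1 \<notin> S" using z by (auto simp: vS)
  moreover have "S \<subseteq> verts n" by (auto simp: S_def)
  ultimately have "S \<noteq> {}" "S \<subset> verts n" using vertex_in_verts[OF n_pos] by blast+
  then obtain e where e: "e \<in> H" "e \<in> cut n S"
    using hamiltonian_cycle_crosses_cut[OF H] n_ge by auto
  then have "e \<in> edges n" "edge_cost n cost e \<noteq> real n" using cheap by (auto simp: cut_def)
  then show False
  proof (cases rule: edge_cases)
    case (1 w)
    define r where "r = w mod int h"
    have r: "0 \<le> r" "r < int h" using h_ge by (auto simp: r_def)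
    \<comment> \<open>The wrap from \<open>h - 1\<close> to \<open>0\<close> creates no further
      crossing: \<open>0\<close> lies outside \<open>{z1<..z2}\<close>, so it crosses only if
      \<open>z2 = h - 1\<close>.\<close>
    have succ: "(w + 1) mod int h = (if r = int h - 1 then 0 else r + 1)"
    proof -
      have "(w + 1) mod int h = (r + 1) mod int h" by (simp add: r_def mod_add_left_eq)
      then show ?thesis using r by auto
    qed
    have "(r \<in> {z1<..z2}) \<noteq> ((w + 1) mod int h \<in> {z1<..z2})"
      using e(2) vS by (simp add: 1 ring_def doubleton_in_cut r_def)
    then have "r = z1 \<or> r = z2" using succ r z by (auto split: if_splits)
    then have "ring w \<notin> H" using empty layer_mod[of H w] by (auto simp: r_def)
    then show False using e 1 by simp
  next
    case (2 w)
    then show False using e(2) vS by (simp add: rung_def doubleton_in_cut)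
  qed simp
qed

lemma inj_on_ring: "inj_on ring {0..<int n}"
proof (rule inj_onI)
  fix a b assume ab: "a \<in> {0..<int n}" "b \<in> {0..<int n}" "ring a = ring b"
  then have "a mod int n = b mod int n" using ring_eq_iff mod_eq_dvd_iff by blast
  then show "a = b" using ab by simp
qed

text \<open>One edge of cost \<open>n\<close> is enough. Otherwise each layer holds 0 or 2 ring
  edges and at most one is empty, so at least \<open>2 * (h - 1)\<close> ring edges of cost 1 are
  used.\<close>

lemma TSPOPT_cost_ge: "real n - 2 \<le> TSPOPT n cost"
proof (rule TSPOPT_ge)
  show "2 \<le> n" using n_ge by simp
  fix H assume H: "hamiltonian_cycle n H"
  have sub: "H \<subseteq> edges n" using H n_ge by (intro hamiltonian_cycle_subset) auto
  have fin: "finite H" using sub finite_edges finite_subset by blast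
  have nonneg: "0 \<le> edge_cost n cost e" if "e \<in> H" for e
    using that sub n_ge cost_nonneg by (intro edge_cost_nonneg) auto
  show "real n - 2 \<le> (\<Sum>e\<in>H. edge_cost n cost e)"
  proof (cases "\<exists>e\<in>H. edge_cost n cost e = real n")
    case True
    then obtain e where "e \<in> H" "edge_cost n cost e = real n" by blast
    then show ?thesis using member_le_sum[of e H "edge_cost n cost"] fin nonneg by simp
  next
    case False
    then have cheap: "\<And>e. e \<in> H \<Longrightarrow> edge_cost n cost e \<noteq> real n" by blast
    define Z where "Z = {z \<in> {0..<int h}. layer H z = 0}"
    have fin_Z: "finite Z" by (rule finite_subset[of _ "{0..<int h}"]) (auto simp: Z_def)
    have "z = w" if "z \<in> Z" "w \<in> Z" for z w
      using that empty_layer_unique[OF H cheap, of z w] empty_layer_unique[OF H cheap, of w z]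
      by (cases z w rule: linorder_cases) (auto simp: Z_def)
    then have "card Z \<le> 1" using card_le_Suc0_iff_eq[OF fin_Z] by simp
    then have "real n - 2 \<le> 2 * real (card ({0..<int h} - Z))"
      using fin_Z by (subst card_Diff_subset) (auto simp: Z_def n_eq)
    also have "\<dots> = (\<Sum>z\<in>{0..<int h} - Z. 2)" by simp
    also have "\<dots> \<le> (\<Sum>z\<in>{0..<int h} - Z. real (layer H z))"
    proof (rule sum_mono)
      fix z assume "z \<in> {0..<int h} - Z"
      then have "layer H z \<noteq> 0" by (simp add: Z_def)
      then have "2 \<le> layer H z" using layer_neq_1[OF H cheap, of z] by linarith
      then show "2 \<le> real (layer H z)" by simp
    qed
    also have "\<dots> \<le> (\<Sum>z\<in>{0..<int h}. real (layer H z))" by (intro sum_mono2) auto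
    also have "\<dots> = (\<Sum>z\<in>{0..<int h}. of_bool (ring z \<in> H)) +
        (\<Sum>z\<in>{0..<int h}. of_bool (ring (z + int h) \<in> H))"
      by (simp add: layer_def sum.distrib)
    also have "(\<Sum>z\<in>{0..<int h}. of_bool (ring (z + int h) \<in> H)) =
        (\<Sum>z\<in>{int h..<int n}. of_bool (ring z \<in> H) :: real)"
      by (rule sum.reindex_bij_witness[of _ "\<lambda>z. z - int h" "\<lambda>z. z + int h"]) (auto simp: int_n)
    also have "(\<Sum>z\<in>{0..<int h}. of_bool (ring z \<in> H)) + \<dots> =
        (\<Sum>z\<in>{0..<int n}. of_bool (ring z \<in> H))"
    proof -
      have "{0..<int n} = {0..<int h} \<union> {int h..<int n}" by (auto simp: int_n)
      moreover have "{0..<int h} \<inter> {int h..<int n} = {}" by auto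
      ultimately show ?thesis by (simp add: sum.union_disjoint del: sum_of_bool_eq)
    qed
    also have "\<dots> =
        (\<Sum>z\<in>{0..<int n}. if ring z \<in> H then edge_cost n cost (ring z) else 0)"
      by (intro sum.cong) (auto simp: edge_cost_ring)
    also have "\<dots> = (\<Sum>z\<in>{z \<in> {0..<int n}. ring z \<in> H}. edge_cost n cost (ring z))"
      by (rule sum.inter_filter[symmetric]) simp
    also have "\<dots> = (\<Sum>e\<in>ring ` {z \<in> {0..<int n}. ring z \<in> H}. edge_cost n cost e)"
      by (subst sum.reindex) (auto intro: inj_on_subset[OF inj_on_ring])
    also have "\<dots> \<le> (\<Sum>e\<in>H. edge_cost n cost e)"
      using fin nonneg by (intro sum_mono2) auto
    finally show ?thesis .
  qed
qed

section \<open>The half-integral LP solution on the ladder\<close>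

definition ladder_lp :: "nat set \<Rightarrow> real" where
  "ladder_lp e = (if e \<in> range rung then 1 else if e \<in> range ring then 1 / 2 else 0)"

lemma ladder_lp_rung: "ladder_lp (rung z) = 1"
  and ladder_lp_ring: "ladder_lp (ring z) = 1 / 2"
  using rung_neq_ring by (auto simp: ladder_lp_def)

lemma ladder_lp_nonneg: "0 \<le> ladder_lp e"
  by (simp add: ladder_lp_def)

text \<open>Otherwise truth would spread from \<open>a\<close> to all larger integers, among them a
  translate of \<open>b\<close> by a multiple of \<open>n\<close>.\<close>

lemma int_exits_up:
  fixes B :: "int \<Rightarrow> bool"
  assumes period: "\<And>z. B (z + int n) = B z" and B: "B a" "\<not> B b"
  shows "\<exists>z. B z \<and> \<not> B (z + 1)"
proof (rule ccontr)
  assume "\<not> ?thesis"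
  then have up: "B z \<Longrightarrow> B (z + 1)" for z by blast
  have ups: "B (a + int i)" for i
  proof (induction i)
    case (Suc i)
    then show ?case using up[of "a + int i"] by (simp add: algebra_simps)
  qed (use B in simp)
  have periods: "B (b + int i * int n) = B b" for i
  proof (induction i)
    case (Suc i)
    then show ?case using period[of "b + int i * int n"] by (simp add: algebra_simps)
  qed simp
  define i where "i = nat \<bar>a - b\<bar>"
  have "\<bar>a - b\<bar> * 1 \<le> \<bar>a - b\<bar> * int n" using n_pos by (intro mult_left_mono) auto
  then have "a \<le> b + int i * int n" by (simp add: i_def)
  then have "B (b + int i * int n)" using ups[of "nat (b + int i * int n - a)"] by simp
  then show False using periods B by blast
qed

lemma subtour_feasible_ladder_lp: "subtour_feasible n ladder_lp"
  unfolding subtour_feasible_def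
proof (intro conjI ballI allI impI)
  fix v assume v: "v \<in> verts n"
  define z where "z = int v - 1"
  have vz: "v = vertex n z" using vertex_surj[OF v] by (simp add: z_def)
  have cut_v: "cut n {v} = {e \<in> edges n. v \<in> e}"
  proof -
    have "card (e \<inter> {v}) = 1 \<longleftrightarrow> v \<in> e" for e :: "nat set" by (cases "v \<in> e") auto
    then show ?thesis by (simp add: cut_def)
  qed
  have "(\<Sum>e\<in>cut n {v}. ladder_lp e) = (\<Sum>e\<in>{ring (z - 1), ring z, rung z}. ladder_lp e)"
  proof (rule sum.mono_neutral_right)
    show "finite (cut n {v})" by (simp add: cut_def finite_edges)
    show "{ring (z - 1), ring z, rung z} \<subseteq> cut n {v}"
      unfolding cut_v unfolding vz
      using ring_in_edges rung_in_edges by (auto simp: vertex_in_ring vertex_in_rung)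
    show "\<forall>e\<in>cut n {v} - {ring (z - 1), ring z, rung z}. ladder_lp e = 0"
      unfolding cut_v unfolding vz by (auto simp: ladder_lp_def vertex_in_ring vertex_in_rung)
  qed
  also have "\<dots> = 2"
  proof -
    have "ring (z - 1) \<noteq> ring z" using not_dvd_consts by (simp add: ring_eq_iff)
    then show ?thesis
      by (simp add: rung_neq_ring rung_neq_ring[symmetric] ladder_lp_ring ladder_lp_rung)
  qed
  finally show "(\<Sum>e\<in>cut n {v}. ladder_lp e) = 2" .
next
  fix S assume S: "S \<noteq> {} \<and> S \<subset> verts n"
  define B where "B z \<longleftrightarrow> vertex n z \<in> S" for z
  have B_cong: "int n dvd a - b \<Longrightarrow> B a = B b" for a b using v_eq_iff[of a b] by (simp add: B_def)
  obtain a b where ab: "B a" "\<not> B b"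
  proof -
    obtain v w where "v \<in> S" "v \<in> verts n" "w \<in> verts n" "w \<notin> S" using S by blast
    then have "B (int v - 1)" "\<not> B (int w - 1)" using vertex_surj[of v n] vertex_surj[of w n]
      by (auto simp: B_def)
    then show thesis by (rule that)
  qed
  \<comment> \<open>Going around the ring, \<open>S\<close> is left at some ring edge
    \<open>i\<close> and entered at some \<open>j\<close>; these edges differ because
    \<open>B i\<close> holds and \<open>B j\<close> fails.\<close>
  obtain i where i: "B i" "\<not> B (i + 1)"
    using int_exits_up[of B a b] ab B_cong by auto
  obtain j where j: "\<not> B j" "B (j + 1)"
    using int_exits_up[of "\<lambda>z. \<not> B z" b a] ab B_cong by auto
  have ring_cut: "ring z \<in> cut n S \<longleftrightarrow> B z \<noteq> B (z + 1)" for z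
    using ring_in_edges[of z] by (auto simp: ring_def doubleton_in_cut B_def)
  have rung_cut: "rung z \<in> cut n S \<longleftrightarrow> B z \<noteq> B (z + int h)" for z
    using rung_in_edges[of z] by (auto simp: rung_def doubleton_in_cut B_def)
  have mono: "(\<Sum>e\<in>T. ladder_lp e) \<le> (\<Sum>e\<in>cut n S. ladder_lp e)" if "T \<subseteq> cut n S" for T
    using that ladder_lp_nonneg finite_edges by (intro sum_mono2) (auto simp: cut_def)
  have ring_neq: "B z \<noteq> B w \<Longrightarrow> ring z \<noteq> ring w" for z w
    using B_cong by (auto simp: ring_eq_iff)
  show "2 \<le> (\<Sum>e\<in>cut n S. ladder_lp e)"
  \<comment> \<open>A crossing rung weighs 1 and the two ring edges 1/2 each. If no rung crosses,
    \<open>B\<close> has period \<open>h\<close>, so the antipodes of both ring edges cross too and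
    give four halves.\<close>
  proof (cases "\<exists>z. B z \<noteq> B (z + int h)")
    case True
    then obtain z where z: "B z \<noteq> B (z + int h)" by blast
    have "(\<Sum>e\<in>{rung z, ring i, ring j}. ladder_lp e) = 2"
      using ring_neq[of i j] i j by (simp add: rung_neq_ring ladder_lp_ring ladder_lp_rung)
    moreover have "{rung z, ring i, ring j} \<subseteq> cut n S" using z i j ring_cut rung_cut by auto
    ultimately show ?thesis using mono by metis
  next
    case False
    then have per: "B (z + int h) = B z" for z by blast
    have "ring z \<noteq> ring (z + int h)" for z using not_dvd_consts by (simp add: ring_eq_iff)
    then have "(\<Sum>e\<in>{ring i, ring (i + int h), ring j, ring (j + int h)}. ladder_lp e) = 2"
      using ring_neq[of i j] ring_neq[of i "j + int h"] ring_neq[of "i + int h" j]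
        ring_neq[of "i + int h" "j + int h"] i j per
      by (simp add: ladder_lp_ring)
    moreover have "{ring i, ring (i + int h), ring j, ring (j + int h)} \<subseteq> cut n S"
      using i j per[of i] per[of j] per[of "i + 1"] per[of "j + 1"]
      by (simp add: ring_cut algebra_simps)
    ultimately show ?thesis using mono by metis
  qed
qed (simp_all add: ladder_lp_def)

text \<open>Rungs are free and edges off the ladder have weight 0, which leaves \<open>n\<close>
  ring edges of weight 1/2 and cost 1.\<close>

lemma LPOPT_cost_le: "LPOPT n cost \<le> real h"
proof -
  have "LPOPT n cost \<le> (\<Sum>e\<in>edges n. edge_cost n cost e * ladder_lp e)"
    using n_ge cost_nonneg subtour_feasible_ladder_lp by (intro LPOPT_le) auto
  also have "\<dots> = (\<Sum>e\<in>ring ` {0..<int n}. edge_cost n cost e * ladder_lp e)"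
  proof (rule sum.mono_neutral_right)
    show "\<forall>e\<in>edges n - ring ` {0..<int n}. edge_cost n cost e * ladder_lp e = 0"
    proof
      fix e assume e: "e \<in> edges n - ring ` {0..<int n}"
      have "ring z \<in> ring ` {0..<int n}" for z
      proof -
        have "ring z = ring (z mod int n)" by (simp add: ring_eq_iff)
        then show ?thesis using n_pos by (intro image_eqI[of _ _ "z mod int n"]) auto
      qed
      then have "e \<notin> range ring" using e by auto
      then show "edge_cost n cost e * ladder_lp e = 0"
        by (auto simp: ladder_lp_def edge_cost_rung)
    qed
  qed (use finite_edges ring_in_edges in auto)
  also have "\<dots> = (\<Sum>z\<in>{0..<int n}. 1 / 2)"
    by (subst sum.reindex[OF inj_on_ring]) (simp add: edge_cost_ring ladder_lp_ring)
  finally show ?thesis by (simp add: n_eq)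
qed

lemma gap_ratio_cost_ge: "ereal (2 - 2 / real h) \<le> gap_ratio n cost"
proof -
  \<comment> \<open>The upper bound serves here to show that \<open>LPOPT\<close> is positive, so
    that the ratio is an ordinary quotient.\<close>
  have "TSPOPT n cost \<le> 2 * LPOPT n cost"
    using n_ge cost_nonneg by (intro TSPOPT_le_twice_LPOPT) auto
  then have pos: "0 < LPOPT n cost" using TSPOPT_cost_ge n_ge by simp
  have "2 - 2 / real h = (real n - 2) / real h" using h_ge by (simp add: n_eq field_simps)
  also have "\<dots> \<le> TSPOPT n cost / LPOPT n cost"
    using TSPOPT_cost_ge LPOPT_cost_le pos n_ge by (intro frac_le) auto
  finally show ?thesis using pos by (simp add: gap_ratio_def)
qed

end

theorem theorem4:
  "(SUP n\<in>{3..}. SUP c\<in>stripe_costs n. gap_ratio n c) = 2"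
proof (rule antisym)
  show "(SUP n\<in>{3..}. SUP c\<in>stripe_costs n. gap_ratio n c) \<le> 2"
    by (intro SUP_least gap_ratio_le_2) auto
next
  let ?s = "SUP n\<in>{3..}. SUP c\<in>stripe_costs n. gap_ratio n c"
  have "ereal (2 + - inverse (real (Suc k))) \<le> ?s" for k
  proof -
    \<comment> \<open>With \<open>h = 2 * Suc k\<close>, which is even, the bound
      \<open>2 - 2 / h\<close> becomes \<open>2 - 1 / Suc k\<close> and tends to 2.\<close>
    interpret moebius_ladder "4 * Suc k" "2 * Suc k" by unfold_locales auto
    have "2 + - inverse (real (Suc k)) = 2 - 2 / real (2 * Suc k)" by (simp add: field_simps)
    then have "ereal (2 + - inverse (real (Suc k))) \<le> gap_ratio (4 * Suc k) cost"
      using gap_ratio_cost_ge by simp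
    also have "\<dots> \<le> (SUP c\<in>stripe_costs (4 * Suc k). gap_ratio (4 * Suc k) c)"
      by (rule SUP_upper[OF cost_in_stripe_costs])
    also have "\<dots> \<le> ?s" by (rule SUP_upper) simp
    finally show ?thesis .
  qed
  moreover have "(\<lambda>k. ereal (2 + - inverse (real (Suc k)))) \<longlonglongrightarrow> ereal 2"
    using LIMSEQ_inverse_real_of_nat_add_minus by (rule tendsto_ereal)
  ultimately have "ereal 2 \<le> ?s" using LIMSEQ_le_const2 by blast
  then show "2 \<le> ?s" by simp
qed

end
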